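(* Let $n>1$ be an integer with exactly $k$ distinct prime factors, where $k>4$, and let $p_k$ be the $k$-th prime. For every odd integer $s$ with $s+1\ge 2e\left(\log\log p_k+\tfrac12\right)$, $$g(n)\le (4\log p_k)\sum_{1\le i\le s}\binom{k}{i}<(4\log p_k)\,k^{1+2e\left(\frac12+\log\log p_k\right)}.$$
   Context: Jacobsthal's function $g(n)$ is the smallest positive integer $m$ such that for every integer $a$ the set $\{a+1,\dots,a+m\}$ contains an integer coprime to $n$. Here $\log$ is the natural logarithm, $e$ is the base of the natural logarithm, and $p_k$ denotes the $k$-th prime ($p_1=2$).
   Formalization: The second inequality (sum < final bound) is false for some large s (e.g. k=88, s=87); it is proved only for the least admissible odd s, while the first inequality and g(n) < final bound are proved for every admissible s. *)

theory Defs
  imports Complex_Main "HOL-Library.Infinite_Set" "HOL-Computational_Algebra.Primes"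
begin

definition jacobsthal :: "nat \<Rightarrow> nat" where
  "jacobsthal n = (LEAST m. m > 0 \<and> (\<forall>a::int. \<exists>x\<in>{a + 1..a + int m}. coprime x (int n)))"

(* 1-based: nth_prime 1 = 2. Since enumerate counts from 0, the junk value nth_prime 0 is also 2. *)
definition nth_prime :: "nat \<Rightarrow> nat" where
  "nth_prime k = enumerate {p. prime p} (k - 1)"

(* For k > 4 the lower bound on s + 1 exceeds 7, so an admissible s is positive.
   Pitfall: the estimate
     (\<Sum>i=1..s. k choose i) < k powr (1 + 2 * e * (1/2 + ln (ln p_k)))
   does not hold for every admissible s (for k = 88 it fails at s = 49); it is a
   statement about the least admissible s, for which s < 1 + 2 * e * (1/2 + ln (ln p_k)). *)
definition admissible :: "nat \<Rightarrow> int \<Rightarrow> bool" where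
  "admissible k s \<longleftrightarrow>
     odd s \<and> real_of_int s + 1 \<ge> 2 * exp 1 * (ln (ln (real (nth_prime k))) + 1 / 2)"

end

theory Submission
  imports Defs
begin

text \<open>
  Let \<open>Q\<close> be the set of the \<open>k\<close> prime factors of \<open>n\<close>, let \<open>N\<close> be the \<open>k\<close>-th prime and put
  \<open>W = ln N\<close>. The proof is Brun's pure sieve. By the Bonferroni inequality, for odd \<open>s\<close> the
  number of integers coprime to \<open>n\<close> in an interval of length \<open>m\<close> is at least the inclusion-exclusion
  sum over the sets \<open>A \<subseteq> Q\<close> with at most \<open>s\<close> elements; replacing the number of multiples of the
  product of \<open>A\<close> by \<open>m\<close> times its density costs at most 1 for each nonempty \<open>A\<close>
  (\<open>brun_sieve_interval\<close>). So the interval contains an integer coprime to \<open>n\<close> as soon as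
  \<open>m * D > (\<Sum>i=1..s. k choose i)\<close>, where \<open>D\<close> is the truncated density, and the first bound follows
  once \<open>D\<close> exceeds \<open>1 / (4 * W)\<close> by a fixed factor. The factor \<open>1 + 1/40\<close> pays for the rounding of
  \<open>m\<close> to an integer.

  The lower bound on \<open>D\<close> (\<open>truncated_density_ge\<close>) compares \<open>D\<close> with the full product of the
  \<open>1 - 1/q\<close>. The sets with more than \<open>s\<close> elements are removed by Rankin's trick with parameter 4
  (\<open>rankin_truncation\<close>): they contribute at most \<open>(\<Prod>q\<in>Q. 1 + 4/q) / 4 ^ (s + 1)\<close>. Among all sets of \<open>k\<close>
  primes, both the product of the \<open>1 - 1/q\<close> and the sum of the \<open>1/q\<close> are extremal for the first \<open>k\<close>
  primes, so what remains are two explicit estimates of Mertens type for \<open>N \<ge> 11\<close>: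
  the sum of \<open>1/p\<close> over the primes \<open>p \<le> N\<close> is at most \<open>ln (ln N) + 3/4\<close>, and the product of the
  \<open>1 - 1/p\<close> is at least \<open>1 / (3 * ln N)\<close>. With these the product contributes \<open>1 / (3 * W)\<close>, while the
  hypothesis on \<open>s\<close> makes the removed part at most \<open>1 / (14 * W)\<close>, which leaves more than
  \<open>1 / (4 * W)\<close>.

  The Mertens estimates are derived in the classical way. Comparing the prime factorization of
  \<open>n!\<close> with an elementary upper bound for \<open>ln n!\<close>, and using \<open>\<theta>(n) \<le> (n - 1) * ln 4\<close>, gives
  \<open>(\<Sum>p\<le>n. ln p / p) \<le> ln n + ln 4 - 1\<close> for all \<open>n \<ge> 1\<close> (\<open>sum_ln_prime_over_prime_le\<close>). Partial summation,
  in the form of an induction that starts at 37, turns this into the bound for the sum of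
  \<open>1/p\<close>. The second and third claims follow by applying the first bound to the least admissible
  \<open>s\<close>, for which \<open>s < 1 + 2 * e * (1/2 + ln W)\<close>, together with
  \<open>(\<Sum>i=1..s. k choose i) \<le> k ^ s\<close>.
\<close>

section \<open>Numerical bounds for logarithms\<close>

text \<open>The bounds for \<open>e\<close> come from \<open>1 + u \<le> exp u\<close> at small \<open>\<bar>u\<bar>\<close>, raised to the tenth power
  several times; rounding to a few digits in between keeps the numerals small.\<close>
lemma power_10_le_exp:
  fixes r u :: real
  assumes "r \<ge> 0" "r \<le> exp u"
  shows "r ^ 10 \<le> exp (10 * u)"
  using power_mono[OF assms(2,1), of 10] by (simp flip: exp_of_nat_mult)

lemma exp_one_ge: "exp (1::real) \<ge> 27/10"
proof -
  have "101/100 \<le> exp (1/100::real)"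
    using exp_ge_add_one_self[of "1/100"] by simp
  from power_10_le_exp[OF _ this] have "11046/10000 \<le> exp (1/10::real)"
    by (simp add: power_divide)
  from power_10_le_exp[OF _ this] show ?thesis
    by (simp add: power_divide)
qed

lemma exp_one_le: "exp (1::real) \<le> 272/100"
proof -
  have "999/1000 \<le> exp (- (1/1000)::real)"
    using exp_ge_add_one_self[of "-1/1000"] by simp
  from power_10_le_exp[OF _ this] have "990044/1000000 \<le> exp (- (1/100)::real)"
    by (simp add: power_divide)
  from power_10_le_exp[OF _ this] have "904783/1000000 \<le> exp (- (1/10)::real)"
    by (simp add: power_divide)
  from power_10_le_exp[OF _ this] have "100/272 \<le> exp (-1::real)"
    by (simp add: power_divide)
  hence "100/272 * exp 1 \<le> exp (-1) * exp (1::real)" by (intro mult_right_mono) auto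
  thus ?thesis by (simp flip: exp_add)
qed

lemma ln_ge_ratioI:
  fixes x :: real
  assumes "x > 0" "b > 0" "(272/100) ^ a \<le> x ^ b"
  shows "real a / real b \<le> ln x"
proof -
  have "exp (real a) = exp 1 ^ a" by (simp flip: exp_of_nat_mult)
  also have "\<dots> \<le> (272/100) ^ a" by (intro power_mono exp_one_le) auto
  also have "\<dots> \<le> x ^ b" by fact
  finally have "real a \<le> ln (x ^ b)" using assms(1) by (subst ln_ge_iff) auto
  also have "\<dots> = real b * ln x" using assms(1) by (simp add: ln_realpow)
  finally show ?thesis using assms(2) by (simp add: field_simps)
qed

lemma ln_le_ratioI:
  fixes x :: real
  assumes "x > 0" "b > 0" "x ^ b \<le> (27/10) ^ a"
  shows "ln x \<le> real a / real b"
proof -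
  have "x ^ b \<le> (27/10) ^ a" by fact
  also have "\<dots> \<le> exp 1 ^ a" by (intro power_mono exp_one_ge) auto
  also have "\<dots> = exp (real a)" by (simp flip: exp_of_nat_mult)
  finally have "ln (x ^ b) \<le> real a" using assms(1) by (metis ln_exp ln_le_cancel_iff exp_gt_zero zero_less_power)
  moreover have "ln (x ^ b) = real b * ln x" using assms(1) by (simp add: ln_realpow)
  ultimately show ?thesis using assms(2) by (simp add: field_simps)
qed

lemma ln_ln_11_ge: "ln (ln 11) \<ge> (6/7::real)"
proof -
  have 1: "31/13 \<le> ln (11::real)"
    using ln_ge_ratioI[of 11 13 31] by (simp add: power_divide)
  have "6/7 \<le> ln (31/13::real)"
    using ln_ge_ratioI[of "31/13" 7 6] by (simp add: power_divide)
  also have "\<dots> \<le> ln (ln 11)" using 1 by simp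
  finally show ?thesis .
qed

lemma ln_4_le: "ln (4::real) \<le> 7/5"
  using ln_le_ratioI[of 4 5 7] by (simp add: power_divide)

text \<open>The fractions have small numerators, so that the powers to be compared stay small, and are
  close enough to the logarithms for the starting point 37 of the induction
  \<open>mertens_induct\<close> below.\<close>
lemma ln_primes_ge:
  "9/13 \<le> ln (2::real)" "12/11 \<le> ln (3::real)" "8/5 \<le> ln (5::real)" "31/16 \<le> ln (7::real)"
    "31/13 \<le> ln (11::real)" "23/9 \<le> ln (13::real)" "14/5 \<le> ln (17::real)" "29/10 \<le> ln (19::real)"
    "25/8 \<le> ln (23::real)" "10/3 \<le> ln (29::real)" "17/5 \<le> ln (31::real)" "18/5 \<le> ln (37::real)"
  using ln_ge_ratioI[of 2 13 9] ln_ge_ratioI[of 3 11 12] ln_ge_ratioI[of 5 5 8]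
      ln_ge_ratioI[of 7 16 31] ln_ge_ratioI[of 11 13 31] ln_ge_ratioI[of 13 9 23]
      ln_ge_ratioI[of 17 5 14] ln_ge_ratioI[of 19 10 29] ln_ge_ratioI[of 23 8 25]
      ln_ge_ratioI[of 29 3 10] ln_ge_ratioI[of 31 5 17] ln_ge_ratioI[of 37 5 18]
  by (simp_all add: power_divide)

section \<open>Upper bounds of Chebyshev and Mertens type\<close>

lemma choose_middle_le: "(2 * m + 1) choose m \<le> 4 ^ m"
proof -
  have "2 * ((2*m+1) choose m) = (\<Sum>i\<in>{m, m+1}. (2*m+1) choose i)"
    using binomial_symmetric[of m "2*m+1"] by simp
  also have "\<dots> \<le> (\<Sum>i\<le>2*m+1. (2*m+1) choose i)" by (intro sum_mono2) auto
  also have "\<dots> = 2 ^ (2*m+1)" by (rule choose_row_sum)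
  also have "\<dots> = 2 * 4 ^ m" by (simp add: power_mult)
  finally show ?thesis by simp
qed

lemma prod_primes_dvd:
  fixes Q :: "nat set"
  assumes "finite Q" "\<And>q. q \<in> Q \<Longrightarrow> prime q" "\<And>q. q \<in> Q \<Longrightarrow> q dvd N"
  shows "\<Prod>Q dvd N"
  using assms
proof (induction Q rule: finite_induct)
  case (insert q Q)
  have "coprime q (\<Prod>Q)"
    using insert by (intro prod_coprime_right) (metis insertCI primes_coprime)
  with insert show ?case by (simp add: divides_mult)
qed simp

lemma sum_ln_le:
  fixes Q :: "nat set"
  assumes "finite Q" "\<And>q. q \<in> Q \<Longrightarrow> q > 0" "\<Prod>Q \<le> N"
  shows "(\<Sum>q\<in>Q. ln (real q)) \<le> ln (real N)"
proof -
  have pos: "0 < \<Prod>Q" using assms(2) by (intro prod_pos) auto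
  have "ln (\<Prod>q\<in>Q. real q) = (\<Sum>q\<in>Q. ln (real q))"
    using assms by (intro ln_prod) auto
  hence "(\<Sum>q\<in>Q. ln (real q)) = ln (real (\<Prod>Q))" by simp
  also have "\<dots> \<le> ln (real N)" using assms(3) pos by (simp del: of_nat_prod)
  finally show ?thesis .
qed

definition primes_upto :: "nat \<Rightarrow> nat set" where
  "primes_upto n = {p. prime p \<and> p \<le> n}"

lemma finite_primes_upto [simp]: "finite (primes_upto n)"
  by (rule finite_subset[of _ "{..n}"]) (auto simp: primes_upto_def)

lemma primes_upto_Suc:
  "primes_upto (Suc n) = (if prime (Suc n) then insert (Suc n) (primes_upto n) else primes_upto n)"
  by (auto simp: primes_upto_def le_Suc_eq)

lemma Suc_notin_primes_upto [simp]: "Suc n \<notin> primes_upto n"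
  by (auto simp: primes_upto_def)

lemma primes_upto_37: "primes_upto 37 = {2, 3, 5, 7, 11, 13, 17, 19, 23, 29, 31, 37}"
proof -
  have "primes_upto 37 = set (filter prime [2..<38])"
    unfolding primes_upto_def set_filter set_upt by (auto dest: prime_ge_2_nat)
  also have "\<dots> = {2, 3, 5, 7, 11, 13, 17, 19, 23, 29, 31, 37}"
    by simp
  finally show ?thesis .
qed

lemma primes_upto_3: "primes_upto 3 = {2, 3}"
proof -
  have "primes_upto 3 = set (filter prime [2..<4])"
    unfolding primes_upto_def set_filter set_upt by (auto dest: prime_ge_2_nat)
  also have "\<dots> = {2, 3}" by simp
  finally show ?thesis .
qed

text \<open>Every prime between \<open>m + 2\<close> and \<open>2 * m + 1\<close> divides the binomial coefficient
  \<open>2 * m + 1 choose m\<close>, which is at most \<open>4 ^ m\<close>.\<close>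
lemma sum_ln_primes_between_le:
  "(\<Sum>p\<in>primes_upto (2*m+1) - primes_upto (m+1). ln (real p)) \<le> real m * ln 4"
proof -
  let ?Q = "primes_upto (2*m+1) - primes_upto (m+1)"
  have "\<Prod>?Q dvd ((2*m+1) choose m)"
  proof (rule prod_primes_dvd)
    fix p assume p: "p \<in> ?Q"
    hence "prime p" "p \<le> 2*m+1" "p > m + 1" by (auto simp: primes_upto_def)
    hence "p dvd fact (2*m+1)" "\<not> p dvd fact m" "\<not> p dvd fact (m+1)"
      by (auto simp: prime_dvd_fact_iff simp del: fact_Suc)
    moreover have "fact m * fact (m+1) * ((2*m+1) choose m) = fact (2*m+1)"
      using binomial_fact_lemma[of m "2*m+1"] by (simp add: mult_2)
    ultimately show "p dvd ((2*m+1) choose m)"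
      using \<open>prime p\<close> by (metis prime_dvd_mult_iff)
  qed (auto simp: primes_upto_def)
  hence "\<Prod>?Q \<le> (2*m+1) choose m"
    by (rule dvd_imp_le) (simp add: zero_less_binomial)
  also have "\<dots> \<le> 4 ^ m" by (rule choose_middle_le)
  finally have "(\<Sum>p\<in>?Q. ln (real p)) \<le> ln (real (4 ^ m))"
    by (intro sum_ln_le) (auto simp: primes_upto_def prime_gt_0_nat)
  thus ?thesis by (simp add: ln_realpow)
qed

text \<open>The Chebyshev function \<open>\<theta>\<close>. Strong induction: an odd \<open>n = 2 * m + 1\<close> is reduced to \<open>m + 1\<close> by the
  previous lemma, and an even \<open>n > 2\<close> to \<open>n - 1\<close>. The constant \<open>n - 1\<close> instead of \<open>n\<close> costs nothing
  here and is what makes the bound for the sum of \<open>ln p / p\<close> free of an error term.\<close>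
lemma sum_ln_primes_upto_le:
  assumes "n \<ge> 1"
  shows "(\<Sum>p\<in>primes_upto n. ln (real p)) \<le> (real n - 1) * ln 4"
  using assms
proof (induction n rule: less_induct)
  case (less n)
  consider "n = 1" | "n = 2" | m where "n = 2*m+1" "m \<ge> 1" | "n > 2" "even n"
  proof (cases "even n")
    case True
    moreover from this have "n \<noteq> 1" by auto
    ultimately show ?thesis using less.prems that(2,4) by (cases "n = 2") linarith+
  next
    case False
    then obtain m where m: "n = 2*m+1" by (elim oddE)
    show ?thesis using that(1) that(3)[OF m] m by (cases "m = 0") simp_all
  qed
  thus ?case
  proof cases
    case 1
    have "primes_upto 1 = {}" by (auto simp: primes_upto_def dest: prime_ge_2_nat)
    with 1 show ?thesis by simp
  next
    case 2
    have "primes_upto 2 = {2}" by (auto simp: primes_upto_def dest: prime_ge_2_nat)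
    with 2 show ?thesis by simp
  next
    case 3
    have "primes_upto n = primes_upto (m+1) \<union> (primes_upto (2*m+1) - primes_upto (m+1))"
      using 3 by (auto simp: primes_upto_def)
    hence "(\<Sum>p\<in>primes_upto n. ln (real p)) = (\<Sum>p\<in>primes_upto (m+1). ln (real p))
       + (\<Sum>p\<in>primes_upto (2*m+1) - primes_upto (m+1). ln (real p))"
      by (metis Diff_disjoint finite_Diff finite_primes_upto sum.union_disjoint)
    also have "\<dots> \<le> (real (m+1) - 1) * ln 4 + real m * ln 4"
      using 3 by (intro add_mono less.IH sum_ln_primes_between_le) auto
    also have "\<dots> = (real n - 1) * ln 4" using 3 by (simp add: algebra_simps)
    finally show ?thesis .
  next
    case 4
    then obtain l where l: "n = Suc l" "l \<ge> 1" by (cases n) auto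
    have "\<not> prime n" using 4 by (metis prime_odd_nat)
    hence "primes_upto n = primes_upto l" using l by (simp add: primes_upto_Suc)
    moreover have "(\<Sum>p\<in>primes_upto l. ln (real p)) \<le> (real l - 1) * ln 4"
      using l by (intro less.IH) auto
    moreover have "(real l - 1) * ln 4 \<le> (real n - 1) * ln (4::real)"
      using l by (intro mult_right_mono) auto
    ultimately show ?thesis by (metis order.trans)
  qed
qed

lemma ln_fact_le:
  assumes "n \<ge> 1"
  shows "ln (fact n) \<le> (real n + 1) * ln (real n) - real n + 1"
  using assms
proof (induction n rule: dec_induct)
  case (step n)
  have "ln (real n / real (Suc n)) \<le> real n / real (Suc n) - 1"
    using step by (intro ln_le_minus_one) auto
  hence "ln (real n) - ln (real (Suc n)) \<le> - 1 / (real n + 1)"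
    using step by (simp add: ln_div field_simps)
  hence "1 \<le> (real n + 1) * (ln (real (Suc n)) - ln (real n))"
    by (simp add: field_simps)
  moreover have "ln (fact (Suc n)) = ln (real (Suc n)) + ln (fact n)"
    using step by (simp add: ln_mult del: of_nat_Suc)
  ultimately show ?case using step by (simp add: algebra_simps)
qed auto

lemma sum_ln_prime_factors_le:
  assumes "m \<ge> (1::nat)"
  shows "(\<Sum>p\<in>prime_factors m. ln (real p)) \<le> ln (real m)"
proof -
  have "\<Prod>(prime_factors m) dvd m"
    by (rule prod_primes_dvd) auto
  hence "\<Prod>(prime_factors m) \<le> m" using assms by (intro dvd_imp_le) auto
  thus ?thesis by (intro sum_ln_le) (auto simp: prime_gt_0_nat in_prime_factors_iff)
qed

lemma card_multiples_upto:
  assumes "p > 0"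
  shows "card {m\<in>{1..n}. p dvd m} = n div p"
proof -
  have "{m\<in>{1..n}. p dvd m} = (\<lambda>j. p * j) ` {1..n div p}"
    using assms by (auto simp: less_eq_div_iff_mult_less_eq mult.commute intro!: image_eqI elim!: dvdE)
  also have "card \<dots> = n div p"
    using assms by (subst card_image) (auto simp: inj_on_def)
  finally show ?thesis .
qed

text \<open>Legendre's formula with the higher prime powers dropped: each \<open>m \<le> n\<close> is at least the product of
  its prime divisors, and \<open>p\<close> occurs in \<open>n div p\<close> of these products.\<close>
lemma sum_floor_ln_primes_le_ln_fact:
  "(\<Sum>p\<in>primes_upto n. real (n div p) * ln (real p)) \<le> ln (fact n)"
proof -
  have "(\<Sum>p\<in>primes_upto n. real (n div p) * ln (real p))
      = (\<Sum>p\<in>primes_upto n. \<Sum>m | m \<in> {1..n} \<and> p dvd m. ln (real p))"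
    by (intro sum.cong refl) (auto simp: primes_upto_def prime_gt_0_nat card_multiples_upto[symmetric])
  also have "\<dots> = (\<Sum>m\<in>{1..n}. \<Sum>p | p \<in> primes_upto n \<and> p dvd m. ln (real p))"
    by (rule sum.swap_restrict) auto
  also have "\<dots> \<le> (\<Sum>m\<in>{1..n}. ln (real m))"
  proof (intro sum_mono)
    fix m assume m: "m \<in> {1..n}"
    have "{p. p \<in> primes_upto n \<and> p dvd m} = prime_factors m"
      using m by (auto simp: primes_upto_def in_prime_factors_iff intro: order.trans[OF dvd_imp_le])
    thus "(\<Sum>p | p \<in> primes_upto n \<and> p dvd m. ln (real p)) \<le> ln (real m)"
      using sum_ln_prime_factors_le[of m] m by auto
  qed
  also have "\<dots> = ln (fact n)"
    by (subst ln_prod[symmetric]) (auto simp: fact_prod)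
  finally show ?thesis .
qed

text \<open>Mertens' first theorem, upper half. Writing \<open>A\<close> for the sum on the left, the estimate
  \<open>n div p \<ge> (n + 1) / p - 1\<close> gives \<open>(n + 1) * A - \<theta>(n) \<le> ln n!\<close>. Using \<open>n + 1\<close> rather than \<open>n\<close> matches
  the term \<open>(n + 1) * ln n\<close> in the bound for \<open>ln n!\<close>, so that no error term of order \<open>ln n / n\<close>
  is left.\<close>
lemma sum_ln_prime_over_prime_le:
  assumes "n \<ge> 1"
  shows "(\<Sum>p\<in>primes_upto n. ln (real p) / real p) \<le> ln (real n) + (ln 4 - 1)"
proof -
  let ?A = "\<Sum>p\<in>primes_upto n. ln (real p) / real p"
  let ?theta = "\<Sum>p\<in>primes_upto n. ln (real p)"
  have "(real n + 1) * ?A - ?theta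
      = (\<Sum>p\<in>primes_upto n. ((real n + 1) / real p - 1) * ln (real p))"
    by (simp add: sum_distrib_left left_diff_distrib sum_subtractf)
  also have "\<dots> \<le> (\<Sum>p\<in>primes_upto n. real (n div p) * ln (real p))"
  proof (intro sum_mono mult_right_mono)
    fix p assume "p \<in> primes_upto n"
    hence p: "p > 1" using prime_gt_1_nat by (auto simp: primes_upto_def)
    have "n < p * (n div p) + p" using p
      using mod_less_divisor[of p n] mult_div_mod_eq[of p n] by linarith
    hence "n + 1 \<le> p * (n div p) + p" by simp
    hence "real (n + 1) \<le> real (p * (n div p) + p)" by (simp only: of_nat_le_iff)
    thus "(real n + 1) / real p - 1 \<le> real (n div p)"
      using p by (simp add: field_simps)
    show "0 \<le> ln (real p)" using p by simp
  qed
  also have "\<dots> \<le> (real n + 1) * ln (real n) - real n + 1"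
    using sum_floor_ln_primes_le_ln_fact[of n] ln_fact_le[OF assms] by linarith
  finally have "(real n + 1) * ?A \<le> (real n + 1) * ln (real n) + (real n - 1) * (ln 4 - 1)"
    using sum_ln_primes_upto_le[OF assms] by (simp add: algebra_simps)
  also have "\<dots> \<le> (real n + 1) * ln (real n) + (real n + 1) * (ln 4 - 1)"
  proof -
    have "1 \<le> ln (4::real)"
      using exp_one_le by (subst ln_ge_iff) auto
    thus ?thesis by (intro add_left_mono mult_right_mono) auto
  qed
  finally have "(real n + 1) * ?A \<le> (real n + 1) * (ln (real n) + (ln 4 - 1))"
    by (simp add: algebra_simps)
  thus ?thesis by (subst (asm) mult_le_cancel_left_pos) auto
qed

section \<open>The sum of the reciprocals of the primes\<close>

lemma mertens_step:
  fixes x y :: real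
  assumes "1 < x" "x < y" "a \<le> ln x + c"
  shows "(ln y + c - a) / ln y - (ln x + c - a) / ln x \<le> ln (ln y) - ln (ln x)"
proof -
  have lx: "ln x > 0" and ly: "ln y > ln x" using assms by auto
  have "(ln y + c - a) / ln y - (ln x + c - a) / ln x = (a - c) * (1 / ln x - 1 / ln y)"
    using lx ly by (simp add: field_simps)
  also have "\<dots> \<le> ln x * (1 / ln x - 1 / ln y)"
    using assms lx ly by (intro mult_right_mono) (auto simp: field_simps)
  also have "\<dots> = 1 - ln x / ln y" using lx by (simp add: field_simps)
  also have "\<dots> \<le> - ln (ln x / ln y)"
    using ln_le_minus_one[of "ln x / ln y"] lx ly by simp
  also have "\<dots> = ln (ln y) - ln (ln x)" using lx ly by (simp add: ln_div)
  finally show ?thesis .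
qed

text \<open>Partial summation as an induction on \<open>n\<close>. The term \<open>(ln n + c - A n) / ln n\<close> is nonnegative by
  \<open>sum_ln_prime_over_prime_le\<close>, and it is chosen so that passing a prime \<open>p\<close> leaves the left-hand side
  unchanged: \<open>S\<close> grows by \<open>1/p\<close> and \<open>A n / ln n\<close> by \<open>(ln p / p) / ln p\<close>. What remains at each step is
  the effect of replacing \<open>ln n\<close> by \<open>ln (n + 1)\<close>, which \<open>mertens_step\<close> bounds by the growth of
  \<open>ln (ln n)\<close>.\<close>
lemma mertens_induct:
  fixes C :: real
  defines "c \<equiv> ln 4 - 1"
  defines "A \<equiv> \<lambda>n. \<Sum>p\<in>primes_upto n. ln (real p) / real p"
  defines "S \<equiv> \<lambda>n. \<Sum>p\<in>primes_upto n. 1 / real p"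
  assumes "1 < y" "y \<le> n"
  assumes base: "S y + (ln (real y) + c - A y) / ln (real y) \<le> ln (ln (real y)) + C"
  shows "S n + (ln (real n) + c - A n) / ln (real n) \<le> ln (ln (real n)) + C"
  using \<open>y \<le> n\<close>
proof (induction n rule: dec_induct)
  case base
  show ?case by fact
next
  case (step n)
  let ?x = "real n" and ?y = "real (Suc n)"
  have n: "n > 1" using step assms by simp
  have ly: "ln ?y > 0" using n by simp
  have "A n \<le> ln ?x + c"
    unfolding A_def c_def using n by (intro sum_ln_prime_over_prime_le) simp
  hence "(ln ?y + c - A n) / ln ?y - (ln ?x + c - A n) / ln ?x \<le> ln (ln ?y) - ln (ln ?x)"
    using n by (intro mertens_step) auto
  moreover have "S (Suc n) + (ln ?y + c - A (Suc n)) / ln ?y = S n + (ln ?y + c - A n) / ln ?y"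
  proof (cases "prime (Suc n)")
    case True
    have "S (Suc n) = S n + 1 / ?y" "A (Suc n) = A n + ln ?y / ?y"
      using True by (simp_all add: S_def A_def primes_upto_Suc)
    moreover have "(ln ?y + c - (A n + ln ?y / ?y)) / ln ?y = (ln ?y + c - A n) / ln ?y - 1 / ?y"
      using ly by (simp add: add_divide_distrib diff_divide_distrib)
    ultimately show ?thesis by simp
  qed (simp add: S_def A_def primes_upto_Suc)
  ultimately show ?case using step.IH by linarith
qed

lemma mertens_base_37:
  "(\<Sum>p\<in>primes_upto 37. 1 / real p) +
   (ln 37 + (ln 4 - 1) - (\<Sum>p\<in>primes_upto 37. ln (real p) / real p)) / ln 37
   \<le> ln (ln 37) + 3/4"
proof -
  note l37 = ln_primes_ge(12)
  have "23/18 \<le> ln (18/5::real)"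
    using ln_ge_ratioI[of "18/5" 18 23] by (simp add: power_divide)
  also have "\<dots> \<le> ln (ln 37)" using l37 by simp
  finally have ll37: "23/18 \<le> ln (ln (37::real))" .
  have u37: "ln (37::real) \<le> 40/11"
    using ln_le_ratioI[of 37 11 40] by (simp add: power_divide)
  have A: "(\<Sum>p\<in>primes_upto 37. ln (real p) / real p) \<ge> 249/100"
    unfolding primes_upto_37 using ln_primes_ge by simp
  have S: "(\<Sum>p\<in>primes_upto 37. 1 / real p) \<le> 1593/1000"
    unfolding primes_upto_37 by simp
  have "(ln 37 + (ln 4 - 1) - (\<Sum>p\<in>primes_upto 37. ln (real p) / real p)) / ln 37
      \<le> (ln 37 - 209/100) / ln (37::real)"
    using A ln_4_le l37 by (intro divide_right_mono) auto
  also have "\<dots> = 1 - (209/100) / ln (37::real)"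
    using l37 by (simp add: field_simps)
  also have "\<dots> \<le> 1 - (209/100) / (40/11)"
    using l37 u37 by (intro diff_left_mono divide_left_mono) auto
  also have "\<dots> = 1701/4000" by simp
  finally show ?thesis using S ll37 by linarith
qed

text \<open>From 37 on this is the induction above. For \<open>11 \<le> n < 37\<close> the sum up to 37 is
  already below \<open>ln (ln 11) + 3/4\<close>.\<close>
lemma sum_inverse_primes_le:
  assumes "n \<ge> 11"
  shows "(\<Sum>p\<in>primes_upto n. 1 / real p) \<le> ln (ln (real n)) + 3/4"
proof (cases "n \<ge> 37")
  case True
  have "(\<Sum>p\<in>primes_upto n. 1 / real p) +
    (ln (real n) + (ln 4 - 1) - (\<Sum>p\<in>primes_upto n. ln (real p) / real p)) / ln (real n)
    \<le> ln (ln (real n)) + 3/4"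
    using mertens_base_37 True mertens_induct[of 37 n "3/4"] by simp
  moreover have "(ln (real n) + (ln 4 - 1) - (\<Sum>p\<in>primes_upto n. ln (real p) / real p)) / ln (real n) \<ge> 0"
    using sum_ln_prime_over_prime_le[of n] assms by (intro divide_nonneg_pos) auto
  ultimately show ?thesis by linarith
next
  case False
  have "(\<Sum>p\<in>primes_upto n. 1 / real p) \<le> (\<Sum>p\<in>primes_upto 37. 1 / real p)"
    using False by (intro sum_mono2) (auto simp: primes_upto_def)
  also have "\<dots> \<le> 6/7 + 3/4"
    unfolding primes_upto_37 by simp
  also have "\<dots> \<le> ln (ln 11) + 3/4" using ln_ln_11_ge by simp
  also have "ln (ln 11) \<le> ln (ln (real n))" using assms by simp
  finally show ?thesis by simp
qed

section \<open>Mertens' product\<close>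

lemma ln_le_half_diff_inverse:
  fixes y :: real
  assumes "y \<ge> 1"
  shows "ln y \<le> (y - 1 / y) / 2"
proof -
  have "(1 - 1 / 1) / 2 - ln 1 \<le> (y - 1 / y) / 2 - ln y"
  proof (rule DERIV_nonneg_imp_nondecreasing[OF assms])
    fix x :: real assume "1 \<le> x" "x \<le> y"
    hence "((\<lambda>y. (y - 1 / y) / 2 - ln y) has_real_derivative (1 - 1 / x)\<^sup>2 / 2) (at x)"
      by (auto intro!: derivative_eq_intros simp: power2_eq_square field_simps)
    thus "\<exists>d. ((\<lambda>y. (y - 1 / y) / 2 - ln y) has_real_derivative d) (at x) \<and> d \<ge> 0"
      by (intro exI conjI) auto
  qed
  thus ?thesis by simp
qed

lemma minus_ln_one_minus_inverse_le:
  fixes x :: real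
  assumes "x > 2"
  shows "- ln (1 - 1 / x) \<le> 1 / x + (1 / (4 * (x - 2)) - 1 / (4 * x))"
proof -
  have "- ln (1 - 1 / x) = ln (x / (x - 1))"
    using assms by (simp add: ln_div field_simps flip: ln_inverse)
  also have "\<dots> \<le> (x / (x - 1) - 1 / (x / (x - 1))) / 2"
    using assms by (intro ln_le_half_diff_inverse) (simp add: field_simps)
  also have "\<dots> = 1 / x + 1 / (2 * x * (x - 1))"
    using assms by (simp add: field_simps)
  also have "1 / (2 * x * (x - 1)) \<le> 1 / (2 * x * (x - 2))"
    using assms by (intro divide_left_mono mult_left_mono) auto
  also have "1 / (2 * x * (x - 2)) = 1 / (4 * (x - 2)) - 1 / (4 * x)"
    using assms by (simp add: field_simps)
  finally show ?thesis by simp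
qed

text \<open>The difference between \<open>- ln (1 - 1/p)\<close> and \<open>1/p\<close> is of order \<open>1 / p\<^sup>2\<close>. For odd \<open>p\<close> it is bounded
  by a telescoping difference of step 2, so summing over all odd numbers instead of the odd primes still
  gives a small constant. At \<open>m = 1\<close>, where the primes are 2 and 3, equality holds.\<close>
lemma sum_minus_ln_primes_le:
  assumes "m \<ge> 1"
  shows "(\<Sum>p\<in>primes_upto (2*m+1). - ln (1 - 1 / real p))
    \<le> (\<Sum>p\<in>primes_upto (2*m+1). 1 / real p) + ln 3 - 3/4 - 1 / (4 * real (2*m+1))"
  using assms
proof (induction m rule: dec_induct)
  case base
  have "ln (3::real) = ln 2 + ln (3/2)" by (simp add: ln_div)
  moreover have "- ln (1/2::real) = ln 2" "- ln (2/3::real) = ln (3/2)" by (simp_all add: ln_div)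
  ultimately show ?case by (simp add: primes_upto_3)
next
  case (step m)
  let ?x = "2 * real m + 3"
  have "\<not> prime (Suc (2 * m + 1))"
    using prime_odd_nat[of "Suc (2*m+1)"] step by auto
  hence *: "primes_upto (2 * Suc m + 1) =
      (if prime (2*m+3) then insert (2*m+3) (primes_upto (2*m+1)) else primes_upto (2*m+1))"
    using primes_upto_Suc[of "2*m+2"] primes_upto_Suc[of "2*m+1"] by (simp add: numeral_3_eq_3)
  have notin: "2*m+3 \<notin> primes_upto (2*m+1)" by (simp add: primes_upto_def)
  have "- ln (1 - 1 / ?x) \<le> 1 / ?x + (1 / (4 * (?x - 2)) - 1 / (4 * ?x))"
    by (rule minus_ln_one_minus_inverse_le) auto
  moreover have "1 / (4 * ?x) \<le> 1 / (4 * (?x - 2))" by (simp add: field_simps)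
  moreover have "real (2 * m + 3) = ?x" "real (2 * Suc m + 1) = ?x" "real (2 * m + 1) = ?x - 2" by simp_all
  ultimately show ?case
    using step.IH notin unfolding * by (cases "prime (2*m+3)") (simp_all add: algebra_simps)
qed

text \<open>Exponentiated, this says that the product of the \<open>1 - 1/p\<close> is at least \<open>1 / (3 * ln n)\<close>. The
  two constants \<open>3/4\<close> cancel.\<close>
lemma sum_minus_ln_primes_le_ln:
  assumes "n \<ge> 11" "odd n"
  shows "(\<Sum>p\<in>primes_upto n. - ln (1 - 1 / real p)) \<le> ln (3 * ln (real n))"
proof -
  obtain m where m: "n = 2*m+1" using assms(2) by (elim oddE)
  have "(\<Sum>p\<in>primes_upto n. - ln (1 - 1 / real p))
    \<le> (\<Sum>p\<in>primes_upto n. 1 / real p) + ln 3 - 3/4 - 1 / (4 * real n)"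
    using sum_minus_ln_primes_le[of m] assms(1) unfolding m by linarith
  moreover have "1 / (4 * real n) \<ge> 0" by simp
  moreover have "ln (3 * ln (real n)) = ln 3 + ln (ln (real n))"
    using assms(1) by (simp add: ln_mult)
  ultimately show ?thesis using sum_inverse_primes_le[OF assms(1)] by linarith
qed

section \<open>Brun's pure sieve\<close>

lemma sum_subsets_card_le:
  assumes "finite Q"
  shows "(\<Sum>A | A \<subseteq> Q \<and> card A \<le> s. f (card A)) = (\<Sum>i\<le>s. real (card Q choose i) * f i)"
proof -
  have "(\<Sum>A | A \<subseteq> Q \<and> card A \<le> s. f (card A))
      = (\<Sum>i\<le>s. \<Sum>A | A \<in> {A. A \<subseteq> Q \<and> card A \<le> s} \<and> card A = i. f (card A))"
    using assms by (intro sum.group[symmetric]) auto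
  also have "\<dots> = (\<Sum>i\<le>s. real (card Q choose i) * f i)"
  proof (intro sum.cong refl)
    fix i assume "i \<in> {..s}"
    hence "{A. A \<in> {A. A \<subseteq> Q \<and> card A \<le> s} \<and> card A = i} = {A. A \<subseteq> Q \<and> card A = i}" by auto
    moreover have "(\<Sum>A | A \<subseteq> Q \<and> card A = i. f (card A)) = (\<Sum>A | A \<subseteq> Q \<and> card A = i. f i)"
      by (intro sum.cong) auto
    ultimately show "(\<Sum>A | A \<in> {A. A \<subseteq> Q \<and> card A \<le> s} \<and> card A = i. f (card A))
        = real (card Q choose i) * f i"
      using n_subsets[OF assms, of i] by simp
  qed
  finally show ?thesis .
qed

text \<open>For a nonempty set with \<open>d + 1\<close> elements the alternating sum of binomial coefficients up to the odd
  index \<open>s\<close> equals \<open>- (d choose s)\<close>.\<close>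
lemma truncated_alternating_le:
  assumes "finite D" "odd s"
  shows "(\<Sum>A | A \<subseteq> D \<and> card A \<le> s. (-1) ^ card A) \<le> (if D = {} then 1 else 0 :: real)"
proof (cases "D = {}")
  case True
  hence "{A. A \<subseteq> D \<and> card A \<le> s} = {{}}" by auto
  thus ?thesis using True by simp
next
  case False
  hence "card D > 0" using assms by (simp add: card_gt_0_iff)
  then obtain d where d: "card D = Suc d" by (cases "card D") auto
  have "(\<Sum>A | A \<subseteq> D \<and> card A \<le> s. (-1) ^ card A :: real)
      = (\<Sum>i\<le>s. (real (card D) gchoose i) * (-1) ^ i)"
    using sum_subsets_card_le[OF assms(1), where s = s and f = "\<lambda>i. (-1) ^ i"] by (simp add: binomial_gbinomial)
  also have "\<dots> = - (real d gchoose s)"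
    using assms(2) by (simp add: gbinomial_sum_lower_neg d)
  also have "\<dots> \<le> 0" by (simp flip: binomial_gbinomial)
  finally show ?thesis using False by simp
qed

lemma brun_count:
  assumes "finite Q" "finite I" "odd s"
  shows "(\<Sum>A | A \<subseteq> Q \<and> card A \<le> s. (-1) ^ card A * real (card {x\<in>I. \<forall>q\<in>A. P q x}))
    \<le> real (card {x\<in>I. \<forall>q\<in>Q. \<not> P q x})"
proof -
  let ?F = "{A. A \<subseteq> Q \<and> card A \<le> s}"
  have fin: "finite ?F" using assms(1) by simp
  have "(\<Sum>A\<in>?F. (-1) ^ card A * real (card {x\<in>I. \<forall>q\<in>A. P q x}))
      = (\<Sum>A\<in>?F. \<Sum>x | x \<in> I \<and> (\<forall>q\<in>A. P q x). (-1) ^ card A)"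
    by (simp add: mult.commute)
  also have "\<dots> = (\<Sum>x\<in>I. \<Sum>A | A \<in> ?F \<and> (\<forall>q\<in>A. P q x). (-1) ^ card A)"
    by (rule sum.swap_restrict[OF fin assms(2)])
  also have "\<dots> \<le> (\<Sum>x\<in>I. if \<forall>q\<in>Q. \<not> P q x then 1 else 0)"
  proof (intro sum_mono)
    fix x
    let ?D = "{q\<in>Q. P q x}"
    have "{A. A \<in> ?F \<and> (\<forall>q\<in>A. P q x)} = {A. A \<subseteq> ?D \<and> card A \<le> s}" by auto
    moreover have "(\<Sum>A | A \<subseteq> ?D \<and> card A \<le> s. (-1) ^ card A) \<le> (if ?D = {} then 1 else 0 :: real)"
      using assms by (intro truncated_alternating_le) auto
    moreover have "?D = {} \<longleftrightarrow> (\<forall>q\<in>Q. \<not> P q x)" by auto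
    ultimately show "(\<Sum>A | A \<in> ?F \<and> (\<forall>q\<in>A. P q x). (-1) ^ card A)
        \<le> (if \<forall>q\<in>Q. \<not> P q x then 1 else 0 :: real)"
      by (simp only:)
  qed
  also have "\<dots> = real (card {x\<in>I. \<forall>q\<in>Q. \<not> P q x})"
    using assms(2) by (simp add: sum.If_cases Int_def)
  finally show ?thesis .
qed

lemma card_multiples_interval:
  fixes a :: int
  assumes "d > 0"
  shows "\<bar>real (card {x\<in>{a+1..a+int m}. int d dvd x}) - real m / real d\<bar> \<le> 1"
proof -
  let ?l = "a div int d" and ?u = "(a + int m) div int d"
  have le_div_iff: "j \<le> z div int d \<longleftrightarrow> int d * j \<le> z" for j z
  proof
    assume "j \<le> z div int d"
    hence "int d * j \<le> int d * (z div int d)" using assms by simp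
    also have "\<dots> \<le> z" using assms mult_div_mod_eq[of "int d" z] pos_mod_sign[of "int d" z] by linarith
    finally show "int d * j \<le> z" .
  next
    assume "int d * j \<le> z"
    hence "(int d * j) div int d \<le> z div int d" using assms by (intro zdiv_mono1) auto
    thus "j \<le> z div int d" using assms by simp
  qed
  have "{x\<in>{a+1..a+int m}. int d dvd x} = (\<lambda>j. int d * j) ` {?l+1..?u}"
  proof (intro equalityI subsetI)
    fix x assume "x \<in> {x\<in>{a+1..a+int m}. int d dvd x}"
    then obtain j where j: "x = int d * j" "a < int d * j" "int d * j \<le> a + int m" by auto
    have "?l < j" using j le_div_iff[of j a] by linarith
    moreover have "j \<le> ?u" using j le_div_iff by simp
    ultimately show "x \<in> (\<lambda>j. int d * j) ` {?l+1..?u}" using j by auto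
  next
    fix x assume "x \<in> (\<lambda>j. int d * j) ` {?l+1..?u}"
    then obtain j where j: "x = int d * j" "j \<in> {?l+1..?u}" by blast
    have "a < int d * j" using j(2) le_div_iff[of j a] by simp
    moreover have "int d * j \<le> a + int m"
      using j le_div_iff by simp
    ultimately show "x \<in> {x\<in>{a+1..a+int m}. int d dvd x}" using j by auto
  qed
  moreover have "inj_on (\<lambda>j. int d * j) {?l+1..?u}" using assms by (auto simp: inj_on_def)
  ultimately have "card {x\<in>{a+1..a+int m}. int d dvd x} = nat (?u - ?l)"
    by (simp add: card_image)
  moreover have "?l \<le> ?u" using assms by (intro zdiv_mono1) auto
  ultimately have card: "real (card {x\<in>{a+1..a+int m}. int d dvd x}) = real_of_int ?u - real_of_int ?l"
    by simp
  have *: "real_of_int (z div int d) \<le> real_of_int z / real d"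
       "real_of_int z / real d < real_of_int (z div int d) + 1" for z
    using assms floor_divide_of_int_eq[of z "int d", where ?'a = real]
    by (simp_all add: floor_eq_iff)
  have "real_of_int (a + int m) / real d = real_of_int a / real d + real m / real d"
    by (simp add: add_divide_distrib)
  thus ?thesis unfolding card using *[of a] *[of "a + int m"] by linarith
qed

text \<open>The empty set is counted exactly, since it corresponds to the whole interval, so the error is a
  sum that starts at \<open>i = 1\<close>.\<close>
lemma brun_sieve_interval:
  fixes a :: int and Q :: "nat set"
  assumes "finite Q" "\<And>q. q \<in> Q \<Longrightarrow> prime q" "odd s"
  shows "real (card {x\<in>{a+1..a+int m}. \<forall>q\<in>Q. \<not> int q dvd x})
    \<ge> real m * (\<Sum>A | A \<subseteq> Q \<and> card A \<le> s. (-1) ^ card A * (\<Prod>q\<in>A. 1 / real q))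
      - (\<Sum>i=1..s. real (card Q choose i))"
proof -
  let ?F = "{A. A \<subseteq> Q \<and> card A \<le> s}"
  let ?I = "{a+1..a+int m}"
  let ?N = "\<lambda>A. real (card {x\<in>?I. \<forall>q\<in>A. int q dvd x})"
  let ?r = "\<lambda>A. \<Prod>q\<in>A. 1 / real q"
  have fin: "finite ?F" using assms(1) by simp
  have err: "(-1) ^ card A * (real m * ?r A) - (if card A = 0 then 0 else 1) \<le> (-1) ^ card A * ?N A"
    if "A \<in> ?F" for A
  proof (cases "A = {}")
    case False
    have A: "A \<subseteq> Q" "finite A" using that assms(1) by (auto intro: finite_subset)
    have "(\<forall>q\<in>A. int q dvd x) \<longleftrightarrow> int (\<Prod>A) dvd x" for x
    proof
      assume "\<forall>q\<in>A. int q dvd x"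
      hence "\<Prod>A dvd nat \<bar>x\<bar>"
        using A assms(2) by (intro prod_primes_dvd) (auto simp: dvd_nat_abs_iff)
      thus "int (\<Prod>A) dvd x" by (simp add: dvd_nat_abs_iff)
    next
      assume x: "int (\<Prod>A) dvd x"
      have "int q dvd int (\<Prod>A)" if "q \<in> A" for q
        using that A by (subst int_dvd_int_iff) (auto intro: dvd_prodI)
      thus "\<forall>q\<in>A. int q dvd x" using x dvd_trans by blast
    qed
    hence N: "?N A = real (card {x\<in>?I. int (\<Prod>A) dvd x})" by (simp del: of_nat_prod)
    have "\<Prod>A > 0" using A assms(2) prime_gt_0_nat by (intro prod_pos) auto
    moreover have "?r A = 1 / real (\<Prod>A)" by (simp add: prod_dividef)
    ultimately have "\<bar>?N A - real m * ?r A\<bar> \<le> 1"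
      using card_multiples_interval[of "\<Prod>A" a m] unfolding N by simp
    hence "\<bar>(-1) ^ card A * (?N A - real m * ?r A)\<bar> \<le> 1" by (simp add: abs_mult)
    hence "-1 \<le> (-1) ^ card A * ?N A - (-1) ^ card A * (real m * ?r A)"
      unfolding right_diff_distrib by linarith
    moreover have "card A \<noteq> 0" using A False by simp
    ultimately show ?thesis by simp
  next
    case True
    have "{x\<in>?I. \<forall>q\<in>A. int q dvd x} = ?I" using True by auto
    hence "?N A = real m" by simp
    thus ?thesis using True by simp
  qed
  have "(\<Sum>A\<in>?F. (if card A = 0 then 0 else 1 :: real))
      = (\<Sum>i\<le>s. real (card Q choose i) * (if i = 0 then 0 else 1))"
    by (rule sum_subsets_card_le[OF assms(1)])
  also have "\<dots> = (\<Sum>i=1..s. real (card Q choose i))"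
    by (intro sum.mono_neutral_cong_right) auto
  finally have "real m * (\<Sum>A\<in>?F. (-1) ^ card A * ?r A) - (\<Sum>i=1..s. real (card Q choose i))
      = (\<Sum>A\<in>?F. (-1) ^ card A * (real m * ?r A) - (if card A = 0 then 0 else 1))"
    by (simp add: sum_subtractf sum_distrib_left mult.left_commute)
  also have "\<dots> \<le> (\<Sum>A\<in>?F. (-1) ^ card A * ?N A)" by (intro sum_mono err)
  also have "\<dots> \<le> real (card {x\<in>?I. \<forall>q\<in>Q. \<not> int q dvd x})"
    using assms by (intro brun_count) auto
  finally show ?thesis .
qed

text \<open>Rankin's trick: a set with more than \<open>s\<close> elements satisfies \<open>1 \<le> t ^ card A / t ^ (s + 1)\<close>, and with
  this weight the sum can be extended to all subsets, where it factors.\<close>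
lemma rankin_truncation:
  fixes x :: "'a \<Rightarrow> real"
  assumes "finite Q" "\<And>q. q \<in> Q \<Longrightarrow> x q \<ge> 0" "t \<ge> 1"
  shows "(\<Prod>q\<in>Q. 1 - x q) - (\<Prod>q\<in>Q. 1 + t * x q) / t ^ (s + 1)
    \<le> (\<Sum>A | A \<subseteq> Q \<and> card A \<le> s. (-1) ^ card A * (\<Prod>q\<in>A. x q))"
proof -
  let ?F = "{A. A \<subseteq> Q \<and> card A \<le> s}" and ?L = "{A. A \<subseteq> Q \<and> card A > s}"
  have nonneg: "(\<Prod>q\<in>A. x q) \<ge> 0" if "A \<subseteq> Q" for A
    using that assms(2) by (intro prod_nonneg) auto
  have "(\<Prod>q\<in>Q. 1 - x q) = (\<Sum>A\<in>Pow Q. (-1) ^ card A * (\<Prod>q\<in>A. x q))"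
    using prod_diff_conv_sum[OF assms(1), of "\<lambda>_. 1" x] by simp
  also have "Pow Q = ?F \<union> ?L" by auto
  also have "(\<Sum>A\<in>?F \<union> ?L. (-1) ^ card A * (\<Prod>q\<in>A. x q))
      = (\<Sum>A\<in>?F. (-1) ^ card A * (\<Prod>q\<in>A. x q)) + (\<Sum>A\<in>?L. (-1) ^ card A * (\<Prod>q\<in>A. x q))"
    using assms(1) by (intro sum.union_disjoint) auto
  also have "(\<Sum>A\<in>?L. (-1) ^ card A * (\<Prod>q\<in>A. x q))
      \<le> (\<Sum>A\<in>?L. (\<Prod>q\<in>A. t * x q) / t ^ (s + 1))"
  proof (intro sum_mono)
    fix A assume A: "A \<in> ?L"
    have "(-1) ^ card A * (\<Prod>q\<in>A. x q) \<le> 1 * (\<Prod>q\<in>A. x q)"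
      using A nonneg[of A] by (intro mult_right_mono) (auto simp: minus_one_power_iff)
    also have "\<dots> \<le> t ^ card A / t ^ (s + 1) * (\<Prod>q\<in>A. x q)"
      using A nonneg[of A] assms(3) power_increasing[of "s+1" "card A" t]
      by (intro mult_right_mono) (auto simp: field_simps)
    also have "\<dots> = (\<Prod>q\<in>A. t * x q) / t ^ (s + 1)"
      by (simp add: prod.distrib)
    finally show "(-1) ^ card A * (\<Prod>q\<in>A. x q) \<le> (\<Prod>q\<in>A. t * x q) / t ^ (s + 1)" .
  qed
  also have "\<dots> \<le> (\<Sum>A\<in>Pow Q. (\<Prod>q\<in>A. t * x q) / t ^ (s + 1))"
    using assms by (intro sum_mono2) (auto intro!: divide_nonneg_nonneg prod_nonneg mult_nonneg_nonneg)
  also have "\<dots> = (\<Prod>q\<in>Q. 1 + t * x q) / t ^ (s + 1)"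
    using prod_add[OF assms(1), of "\<lambda>q. t * x q" "\<lambda>_. 1"]
    by (simp add: sum_divide_distrib add.commute)
  finally show ?thesis by simp
qed

section \<open>The truncated density of the integers coprime to \<open>n\<close>\<close>

lemma primes_upto_nth_prime:
  assumes "k \<ge> 1"
  shows "primes_upto (nth_prime k) = enumerate {p. prime p} ` {..<k}"
proof -
  let ?e = "enumerate {p :: nat. prime p}"
  have le_iff: "?e i \<le> ?e j \<longleftrightarrow> i \<le> j" for i j
    by (rule enumerate_mono_le_iff[OF primes_infinite])
  have "primes_upto (?e (k - 1)) = ?e ` {..<k}"
  proof (intro equalityI subsetI)
    fix p assume p: "p \<in> primes_upto (?e (k - 1))"
    hence "p \<in> {p. prime p}" by (simp add: primes_upto_def)
    then obtain m where m: "?e m = p"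
      using enumerate_Ex[OF primes_infinite, of p] by blast
    hence "?e m \<le> ?e (k - 1)" using p by (simp add: primes_upto_def)
    hence "m \<le> k - 1" using le_iff by blast
    hence "m < k" using assms by simp
    thus "p \<in> ?e ` {..<k}" using m by blast
  next
    fix p assume "p \<in> ?e ` {..<k}"
    then obtain m where m: "p = ?e m" "m < k" by blast
    hence "p \<le> ?e (k - 1)" using le_iff by simp
    moreover have "prime p" using m enumerate_in_set[OF primes_infinite, of m] by simp
    ultimately show "p \<in> primes_upto (?e (k - 1))" by (simp add: primes_upto_def)
  qed
  thus ?thesis unfolding nth_prime_def .
qed

lemma card_primes_upto_nth_prime:
  assumes "k \<ge> 1"
  shows "card (primes_upto (nth_prime k)) = k"
proof -
  have "inj_on (enumerate {p :: nat. prime p}) {..<k}"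
    by (intro inj_onI) (metis enumerate_mono[OF _ primes_infinite] linorder_neqE_nat less_irrefl)
  thus ?thesis using primes_upto_nth_prime[OF assms] by (simp add: card_image)
qed

lemma prime_nth_prime: "prime (nth_prime k)"
  using enumerate_in_set[OF primes_infinite, of "k - 1"] by (simp add: nth_prime_def)

lemma nth_prime_ge_11:
  assumes "k > 4"
  shows "nth_prime k \<ge> 11"
proof (rule ccontr)
  assume "\<not> nth_prime k \<ge> 11"
  hence "primes_upto (nth_prime k) \<subseteq> primes_upto 37 \<inter> {..10}"
    by (auto simp: primes_upto_def)
  also have "\<dots> \<subseteq> {2, 3, 5, 7}" unfolding primes_upto_37 by auto
  finally have "card (primes_upto (nth_prime k)) \<le> card {2, 3, 5, 7 :: nat}"
    by (rule card_mono[rotated]) auto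
  thus False using card_primes_upto_nth_prime[of k] assms by simp
qed

text \<open>The elements of \<open>Q\<close> beyond \<open>N\<close> are as many as the primes up to \<open>N\<close> missing from \<open>Q\<close>, and \<open>f N\<close>
  separates the values of \<open>f\<close> on the two sets.\<close>
lemma sum_primes_le_initial:
  fixes f :: "nat \<Rightarrow> real"
  assumes "finite Q" "\<And>q. q \<in> Q \<Longrightarrow> prime q" "card Q = card (primes_upto N)" "N \<ge> 2"
  assumes anti: "\<And>a b. 2 \<le> a \<Longrightarrow> a \<le> b \<Longrightarrow> f b \<le> f a"
  shows "sum f Q \<le> sum f (primes_upto N)"
proof -
  let ?P = "primes_upto N"
  have "card (Q - ?P) = card (?P - Q)"
    using assms(1,3) card_Diff_subset_Int[of Q ?P] card_Diff_subset_Int[of ?P Q]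
    by (simp add: Int_commute)
  have "sum f (Q - ?P) \<le> of_nat (card (Q - ?P)) * f N"
    using assms by (intro sum_bounded_above anti) (auto simp: primes_upto_def)
  also have "\<dots> = of_nat (card (?P - Q)) * f N" by (simp add: \<open>card (Q - ?P) = card (?P - Q)\<close>)
  also have "\<dots> \<le> sum f (?P - Q)"
    by (intro sum_bounded_below anti) (auto simp: primes_upto_def prime_ge_2_nat)
  finally have "sum f (Q - ?P) \<le> sum f (?P - Q)" .
  moreover have "sum f Q = sum f (Q \<inter> ?P) + sum f (Q - ?P)"
    using assms(1) by (rule sum.Int_Diff)
  moreover have "sum f ?P = sum f (?P \<inter> Q) + sum f (?P - Q)"
    by (rule sum.Int_Diff) simp
  ultimately show ?thesis by (simp add: Int_commute)
qed

text \<open>Here \<open>u\<close> stands for \<open>ln (ln N)\<close> and \<open>r\<close> for \<open>s + 1\<close>. The exponent is at most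
  \<open>3 - B / 2 - (B - 5) * u\<close> with \<open>B = 2 * e * ln 4 > 7\<close>, hence decreasing in \<open>u\<close>, and at \<open>u = 6/7\<close>
  it is below \<open>-14/5\<close>.\<close>
lemma rankin_error_le:
  fixes u r :: real
  assumes "u \<ge> 6/7" "r \<ge> 2 * exp 1 * (u + 1/2)"
  shows "exp (4 * (u + 3/4) - r * ln 4 + u) \<le> 1/14"
proof -
  have "5 * u + 3 - r * ln 4 \<le> - (14/5)"
  proof -
    have ln4: "18/13 \<le> ln (4::real)"
    proof -
      have "ln (4::real) = 2 * ln 2" using ln_realpow[of 2 2] by simp
      thus ?thesis using ln_primes_ge(1) by simp
    qed
    have "2 * (27/10) * (u + 1/2) \<le> 2 * exp 1 * (u + 1/2)"
      using exp_one_ge assms(1) by (intro mult_right_mono) auto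
    hence r: "r \<ge> 2 * (27/10) * (u + 1/2)" using assms(2) by linarith
    have "2 * (27/10) * (u + 1/2) * (18/13) \<le> r * ln 4"
      using r ln4 assms(1) by (intro mult_mono) auto
    thus ?thesis using assms(1) by (simp add: algebra_simps)
  qed
  moreover have "ln (14::real) \<le> 14/5"
    using ln_le_ratioI[of 14 5 14] by (simp add: power_divide)
  ultimately have "4 * (u + 3/4) - r * ln 4 + u \<le> - ln 14"
    by (simp add: algebra_simps)
  hence "exp (4 * (u + 3/4) - r * ln 4 + u) \<le> exp (- ln (14::real))" by simp
  also have "\<dots> = 1/14" by (simp add: exp_minus)
  finally show ?thesis .
qed

lemma truncated_density_ge:
  fixes Q :: "nat set"
  assumes Q: "finite Q" "\<And>q. q \<in> Q \<Longrightarrow> prime q" "card Q = card (primes_upto N)"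
  assumes N: "prime N" "N \<ge> 11"
  assumes s: "real s + 1 \<ge> 2 * exp 1 * (ln (ln (real N)) + 1/2)"
  shows "(1 + 1/40) / (4 * ln (real N))
    \<le> (\<Sum>A | A \<subseteq> Q \<and> card A \<le> s. (-1) ^ card A * (\<Prod>q\<in>A. 1 / real q))"
proof -
  define W where "W = ln (real N)"
  define u where "u = ln W"
  have q2: "real q \<ge> 2" if "q \<in> Q" for q using Q(2)[OF that] prime_ge_2_nat by force
  have W1: "W > 1"
  proof -
    have "ln 11 \<le> W" using N by (simp add: W_def)
    thus ?thesis using ln_primes_ge(5) by linarith
  qed
  have u: "u \<ge> 6/7"
  proof -
    have "ln (ln 11) \<le> u" using N by (simp add: u_def W_def)
    thus ?thesis using ln_ln_11_ge by linarith
  qed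
  have expu: "exp u = W" using W1 by (simp add: u_def)
  have "odd N" using N prime_odd_nat[of N] by simp

  have "(\<Sum>q\<in>Q. - ln (1 - 1 / real q)) \<le> (\<Sum>q\<in>primes_upto N. - ln (1 - 1 / real q))"
    using Q N by (intro sum_primes_le_initial) (auto simp: field_simps)
  also have "\<dots> \<le> ln (3 * W)"
    unfolding W_def using N \<open>odd N\<close> by (intro sum_minus_ln_primes_le_ln) auto
  finally have "exp (- ln (3 * W)) \<le> exp (- (\<Sum>q\<in>Q. - ln (1 - 1 / real q)))" by simp
  also have "\<dots> = (\<Prod>q\<in>Q. exp (ln (1 - 1 / real q)))"
    using Q(1) by (simp add: exp_sum sum_negf)
  also have "\<dots> = (\<Prod>q\<in>Q. 1 - 1 / real q)"
    using q2 by (intro prod.cong refl exp_ln) (force simp: field_simps)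
  also have "exp (- ln (3 * W)) = 1 / (3 * W)"
    using W1 by (simp add: exp_minus inverse_eq_divide)
  finally have main: "1 / (3 * W) \<le> (\<Prod>q\<in>Q. 1 - 1 / real q)" .

  have "(\<Sum>q\<in>Q. 1 / real q) \<le> (\<Sum>q\<in>primes_upto N. 1 / real q)"
    using Q N by (intro sum_primes_le_initial) (auto simp: field_simps)
  also have "\<dots> \<le> u + 3/4"
    unfolding u_def W_def using N by (intro sum_inverse_primes_le)
  finally have L: "(\<Sum>q\<in>Q. 1 / real q) \<le> u + 3/4" .
  have "(\<Prod>q\<in>Q. 1 + 4 * (1 / real q)) \<le> (\<Prod>q\<in>Q. exp (4 * (1 / real q)))"
    by (intro prod_mono conjI exp_ge_add_one_self) auto
  also have "\<dots> = exp (4 * (\<Sum>q\<in>Q. 1 / real q))"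
    using Q(1) by (simp add: exp_sum sum_distrib_left)
  also have "\<dots> \<le> exp (4 * (u + 3/4))" using L by simp
  finally have prod_le: "(\<Prod>q\<in>Q. 1 + 4 * (1 / real q)) \<le> exp (4 * (u + 3/4))" .
  have "(4::real) ^ (s + 1) = exp ((real s + 1) * ln 4)"
    using exp_of_nat_mult[of "s + 1" "ln (4::real)"] by (simp add: add.commute)
  hence "(\<Prod>q\<in>Q. 1 + 4 * (1 / real q)) / 4 ^ (s + 1)
      \<le> exp (4 * (u + 3/4)) / exp ((real s + 1) * ln 4)"
    using prod_le by (simp only:) (intro divide_right_mono, auto)
  also have "exp (4 * (u + 3/4)) / exp ((real s + 1) * ln 4)
      = exp (4 * (u + 3/4) - (real s + 1) * ln 4 + u) / W"
    unfolding exp_add[of _ u] exp_diff expu using W1 by simp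
  also have "\<dots> \<le> (1/14) / W"
    using s u W1 unfolding u_def W_def by (intro divide_right_mono rankin_error_le) auto
  finally have error: "(\<Prod>q\<in>Q. 1 + 4 * (1 / real q)) / 4 ^ (s + 1) \<le> (1/14) / W" .

  have "(1 + 1/40) / (4 * W) \<le> 1 / (3 * W) - (1/14) / W"
    using W1 by (simp add: field_simps)
  also have "\<dots> \<le> (\<Prod>q\<in>Q. 1 - 1 / real q) - (\<Prod>q\<in>Q. 1 + 4 * (1 / real q)) / 4 ^ (s + 1)"
    using main error by linarith
  also have "\<dots> \<le> (\<Sum>A | A \<subseteq> Q \<and> card A \<le> s. (-1) ^ card A * (\<Prod>q\<in>A. 1 / real q))"
    using Q(1) by (intro rankin_truncation) auto
  finally show ?thesis unfolding W_def .
qed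

section \<open>Jacobsthal's function\<close>

lemma coprime_if_no_prime_factor_dvd:
  assumes "n > 0" "\<And>q. q \<in> prime_factors n \<Longrightarrow> \<not> int q dvd x"
  shows "coprime x (int n)"
proof (rule ccontr)
  assume "\<not> coprime x (int n)"
  hence "nat \<bar>gcd x (int n)\<bar> \<noteq> 1" by (simp add: coprime_iff_gcd_eq_1)
  then obtain q where q: "prime q" "int q dvd gcd x (int n)"
    using prime_factor_nat unfolding dvd_nat_abs_iff[symmetric] by blast
  hence "q \<in> prime_factors n" "int q dvd x" using assms(1)
    by (auto simp: in_prime_factors_iff)
  with assms(2) show False by blast
qed

lemma jacobsthal_le_if_sieve:
  fixes n m s :: nat
  assumes "n > 0" "odd s"
  assumes pos: "real m * (\<Sum>A | A \<subseteq> prime_factors n \<and> card A \<le> s. (-1) ^ card A * (\<Prod>q\<in>A. 1 / real q))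
      > (\<Sum>i=1..s. real (card (prime_factors n) choose i))"
  shows "jacobsthal n \<le> m"
  unfolding jacobsthal_def
proof (intro Least_le conjI allI)
  show "m > 0"
  proof (rule ccontr)
    assume "\<not> m > 0"
    moreover have "(\<Sum>i=1..s. real (card (prime_factors n) choose i)) \<ge> 0" by (intro sum_nonneg) auto
    ultimately show False using pos by simp
  qed
  fix a :: int
  have "real (card {x\<in>{a+1..a+int m}. \<forall>q\<in>prime_factors n. \<not> int q dvd x}) > 0"
    using brun_sieve_interval[of "prime_factors n" s m a] pos assms(2)
    by (auto simp: in_prime_factors_iff)
  hence "{x\<in>{a+1..a+int m}. \<forall>q\<in>prime_factors n. \<not> int q dvd x} \<noteq> {}"
    by (metis card.empty of_nat_0 less_irrefl)
  thus "\<exists>x\<in>{a + 1..a + int m}. coprime x (int n)"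
    using coprime_if_no_prime_factor_dvd[OF assms(1)] by blast
qed

text \<open>The interval length is \<open>m = \<lfloor>G\<rfloor>\<close>, which may be smaller than \<open>G\<close> by almost 1. The factor \<open>1 + 1/40\<close> in the
  density bound makes up for this because \<open>G > 41\<close>.\<close>
lemma jacobsthal_le_sum_choose:
  fixes n k s :: nat
  assumes "n > 0" "card (prime_factors n) = k" "k > 4" "odd s"
  assumes s: "real s + 1 \<ge> 2 * exp 1 * (ln (ln (real (nth_prime k))) + 1/2)"
  shows "real (jacobsthal n) \<le> 4 * ln (real (nth_prime k)) * (\<Sum>i=1..s. real (k choose i))"
proof -
  define W where "W = ln (real (nth_prime k))"
  define B where "B = (\<Sum>i=1..s. real (k choose i))"
  define G where "G = 4 * W * B"
  define D where "D = (\<Sum>A | A \<subseteq> prime_factors n \<and> card A \<le> s. (-1) ^ card A * (\<Prod>q\<in>A. 1 / real q))"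
  note p11 = nth_prime_ge_11[OF assms(3)]
  have "W \<ge> ln 11" using p11 by (simp add: W_def)
  hence W: "W \<ge> 31/13" using ln_primes_ge(5) by linarith
  have "real (k choose 1) \<le> B"
    unfolding B_def using assms(4) by (intro member_le_sum) (auto elim: oddE)
  hence "B \<ge> 5" using assms(3) by simp
  hence "4 * (31/13) * 5 \<le> G" unfolding G_def using W by (intro mult_mono) auto
  hence G: "G > 41" by simp
  have D: "(1 + 1/40) / (4 * W) \<le> D"
    unfolding D_def W_def
  proof (rule truncated_density_ge[OF _ _ _ prime_nth_prime p11 s])
    show "card (prime_factors n) = card (primes_upto (nth_prime k))"
      using card_primes_upto_nth_prime[of k] assms(2,3) by simp
  qed auto
  have "jacobsthal n \<le> nat \<lfloor>G\<rfloor>"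
  proof (rule jacobsthal_le_if_sieve[OF \<open>n > 0\<close> \<open>odd s\<close>])
    have "B = G / (4 * W)" using W by (simp add: G_def)
    also have "\<dots> < (G - 1) * ((1 + 1/40) / (4 * W))"
      using W G by (simp add: field_simps)
    also have "\<dots> \<le> (G - 1) * D" using D G by (intro mult_left_mono) auto
    also have "\<dots> \<le> real (nat \<lfloor>G\<rfloor>) * D"
    proof (rule mult_right_mono)
      show "G - 1 \<le> real (nat \<lfloor>G\<rfloor>)" using G by linarith
      have "0 \<le> (1 + 1/40) / (4 * W)" using W by simp
      thus "0 \<le> D" using D by linarith
    qed
    finally show "(\<Sum>i=1..s. real (card (prime_factors n) choose i)) < real (nat \<lfloor>G\<rfloor>) *
       (\<Sum>A | A \<subseteq> prime_factors n \<and> card A \<le> s. (-1) ^ card A * (\<Prod>q\<in>A. 1 / real q))"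
      unfolding B_def D_def assms(2) .
  qed
  moreover have "real (nat \<lfloor>G\<rfloor>) \<le> G" using G by linarith
  ultimately show ?thesis unfolding G_def W_def B_def by linarith
qed

text \<open>In the induction step, \<open>(s + 1) * (k choose (s + 1)) = (k - s) * (k choose s) \<le> (k - 1) * k ^ s\<close>.\<close>
lemma sum_choose_le_power:
  assumes "s \<ge> 1" "k \<ge> 1"
  shows "(\<Sum>i=1..s. k choose i) \<le> k ^ s"
  using assms(1)
proof (induction s rule: dec_induct)
  case base
  show ?case by simp
next
  case (step s)
  have "Suc s * (k choose Suc s) = (k - s) * (k choose s)"
    using binomial_absorption[of s k] binomial_absorb_comp[of k s] by simp
  also have "\<dots> \<le> (k - 1) * k ^ s"
  proof (cases "s \<le> k")
    case True
    thus ?thesis using step binomial_le_pow[of s k] by (intro mult_mono) auto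
  qed simp
  finally have "(k choose Suc s) \<le> (k - 1) * k ^ s"
    by (rule order.trans[rotated]) simp
  hence "(\<Sum>i=1..Suc s. k choose i) \<le> k ^ s + (k - 1) * k ^ s" using step by simp
  also have "\<dots> = k ^ Suc s" using assms(2) by (cases k) auto
  finally show ?case .
qed

text \<open>Minimality excludes \<open>s - 2\<close>, which is odd as well, and this bounds \<open>s\<close> from above.\<close>
lemma least_admissible_sum_less:
  assumes "admissible k s" "s \<ge> 1" "k \<ge> 2" and least: "\<And>t. admissible k t \<Longrightarrow> s \<le> t"
  shows "(\<Sum>i=1..nat s. real (k choose i))
    < real k powr (1 + 2 * exp 1 * (1 / 2 + ln (ln (real (nth_prime k)))))"
proof -
  have "\<not> admissible k (s - 2)" using least[of "s - 2"] by auto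
  hence "real_of_int s < 1 + 2 * exp 1 * (1 / 2 + ln (ln (real (nth_prime k))))"
    using assms(1) by (simp add: admissible_def add.commute)
  hence s: "real (nat s) < 1 + 2 * exp 1 * (1 / 2 + ln (ln (real (nth_prime k))))"
    using assms(2) by simp
  have "(\<Sum>i=1..nat s. real (k choose i)) = real (\<Sum>i=1..nat s. k choose i)" by simp
  also have "\<dots> \<le> real (k ^ nat s)"
    using assms by (intro of_nat_mono sum_choose_le_power) auto
  also have "\<dots> = real k powr real (nat s)" using assms(3) by (simp add: powr_realpow)
  also have "\<dots> < real k powr (1 + 2 * exp 1 * (1 / 2 + ln (ln (real (nth_prime k)))))"
    using s assms(3) by (intro powr_less_mono) auto
  finally show ?thesis .
qed

lemma admissible_ge_1:
  assumes "k > 4" "admissible k s"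
  shows "s \<ge> 1"
proof -
  have "ln (ln 11) \<le> ln (ln (real (nth_prime k)))" using nth_prime_ge_11[OF assms(1)] by simp
  hence "1 < ln (ln (real (nth_prime k))) + 1/2" using ln_ln_11_ge by linarith
  hence "2 * (27/10) * 1 \<le> 2 * exp 1 * (ln (ln (real (nth_prime k))) + 1/2)"
    using exp_one_ge by (intro mult_mono) auto
  thus ?thesis using assms(2) by (simp add: admissible_def)
qed

theorem mainTheorem2:
  fixes n k :: nat
  assumes "n > 1" and "card (prime_factors n) = k" and "k > 4"
  shows "\<forall>s::int. admissible k s \<longrightarrow>
           real (jacobsthal n)
             \<le> 4 * ln (real (nth_prime k)) * (\<Sum>i=1..nat s. real (k choose i)) \<and>
           real (jacobsthal n)
             < 4 * ln (real (nth_prime k)) *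
               real k powr (1 + 2 * exp 1 * (1 / 2 + ln (ln (real (nth_prime k))))) \<and>
           ((\<forall>t. admissible k t \<longrightarrow> s \<le> t) \<longrightarrow>
             4 * ln (real (nth_prime k)) * (\<Sum>i=1..nat s. real (k choose i))
               < 4 * ln (real (nth_prime k)) *
                 real k powr (1 + 2 * exp 1 * (1 / 2 + ln (ln (real (nth_prime k))))))"
proof (intro allI impI conjI)
  fix s assume s: "admissible k s"
  have bound: "real (jacobsthal n) \<le> 4 * ln (real (nth_prime k)) * (\<Sum>i=1..nat t. real (k choose i))"
    if t: "admissible k t" for t
  proof (rule jacobsthal_le_sum_choose)
    have "t \<ge> 1" using admissible_ge_1 t assms(3) by blast
    thus "odd (nat t)" "real (nat t) + 1 \<ge> 2 * exp 1 * (ln (ln (real (nth_prime k))) + 1/2)"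
      using t by (auto simp: admissible_def even_nat_iff)
  qed (use assms in auto)
  have strict: "4 * ln (real (nth_prime k)) * (\<Sum>i=1..nat t. real (k choose i))
      < 4 * ln (real (nth_prime k)) *
        real k powr (1 + 2 * exp 1 * (1 / 2 + ln (ln (real (nth_prime k)))))"
    if t: "admissible k t" and least: "\<And>t'. admissible k t' \<Longrightarrow> t \<le> t'" for t
    using least_admissible_sum_less[OF t _ _ least] admissible_ge_1[OF assms(3) t] assms(3)
      nth_prime_ge_11[OF assms(3)] by (intro mult_strict_left_mono) auto
  show "real (jacobsthal n) \<le> 4 * ln (real (nth_prime k)) * (\<Sum>i=1..nat s. real (k choose i))"
    by (rule bound[OF s])
  show "4 * ln (real (nth_prime k)) * (\<Sum>i=1..nat s. real (k choose i))
      < 4 * ln (real (nth_prime k)) *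
        real k powr (1 + 2 * exp 1 * (1 / 2 + ln (ln (real (nth_prime k)))))"
    if "\<forall>t. admissible k t \<longrightarrow> s \<le> t"
    using that by (intro strict s) auto
  define j where "j = (LEAST j. admissible k (int j))"
  have "admissible k (int (nat s))" using s admissible_ge_1[OF assms(3) s] by simp
  hence j: "admissible k (int j)" unfolding j_def by (rule LeastI)
  have "int j \<le> t" if t: "admissible k t" for t
  proof -
    have "t \<ge> 1" by (rule admissible_ge_1[OF assms(3) t])
    hence "admissible k (int (nat t))" using t by simp
    hence "j \<le> nat t" unfolding j_def by (rule Least_le)
    thus ?thesis using \<open>t \<ge> 1\<close> by simp
  qed
  with bound[OF j] strict[OF j]
  show "real (jacobsthal n) < 4 * ln (real (nth_prime k)) *
      real k powr (1 + 2 * exp 1 * (1 / 2 + ln (ln (real (nth_prime k)))))"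
    by fastforce
qed

end
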